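(* Let $f$ and $g$ be transcendental entire functions. Then: (i) $AV(f)\subset AV(f\circ g)$; (ii) $g(CV(f))\subset CV(g\circ f)$.
   Context: For an entire function $h$: $CV(h)=\{h(z): z\in\mathbb{C},\ h'(z)=0\}$ is the set of critical values; a point $\zeta\in\mathbb{C}$ is an asymptotic value of $h$ if there exists a curve $\Gamma$ tending to infinity such that $h(z)\to\zeta$ as $z\to\infty$ along $\Gamma$, and $AV(h)\subset\mathbb{C}$ is the set of all asymptotic values of $h$. *)

theory Defs
  imports "HOL-Complex_Analysis.Complex_Analysis" "HOL-Computational_Algebra.Polynomial"
begin

definition transcendental_entire :: "(complex \<Rightarrow> complex) \<Rightarrow> bool" where
  "transcendental_entire f \<longleftrightarrow> f holomorphic_on UNIV \<and> \<not> (\<exists>p :: complex poly. \<forall>z. f z = poly p z)"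

definition critical_values :: "(complex \<Rightarrow> complex) \<Rightarrow> complex set" where
  "critical_values h = {h z | z. deriv h z = 0}"

(* Parametrized on [0, \<infinity>); the values of \<gamma> at negative arguments are irrelevant. *)
definition curve_to_infinity :: "(real \<Rightarrow> complex) \<Rightarrow> bool" where
  "curve_to_infinity \<gamma> \<longleftrightarrow> continuous_on {0..} \<gamma> \<and> filterlim \<gamma> at_infinity at_top"

definition asymptotic_values :: "(complex \<Rightarrow> complex) \<Rightarrow> complex set" where
  "asymptotic_values h =
     {\<zeta>. \<exists>\<gamma>. curve_to_infinity \<gamma> \<and> ((\<lambda>t. h (\<gamma> t)) \<longlongrightarrow> \<zeta>) at_top}"

end

theory Submission
  imports Defs
begin

text \<open>For the asymptotic values, a curve \<open>\<gamma>\<close> on which \<open>f\<close> tends to \<open>\<zeta>\<close> need not lift through \<open>g\<close>,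
  but a nearby curve does. Cover the pieces of \<open>\<gamma>\<close> by bounded domains \<open>V k\<close>, thin enough that
  \<open>f\<close> varies little across them. By a Phragmen--Lindeloef argument, \<open>g\<close> maps every component of
  the preimage of \<open>V k\<close> onto a dense subset of \<open>V k\<close>, so from a component over \<open>V k\<close> one can
  always reach a point over \<open>V (k + 1)\<close>. Concatenating paths inside these components gives a
  curve whose image under \<open>g\<close> follows \<open>\<gamma>\<close>; it tends to infinity because \<open>g\<close> is bounded on
  bounded sets.\<close>

section \<open>A maximum principle for bounded functions on unbounded domains\<close>

text \<open>A high power of \<open>h / M\<close> amplifies any excess over the frontier bound, while
  the single factor \<open>\<rho> / (z - z0)\<close> supplies decay at infinity. The product is
  controlled by the ordinary maximum principle on the part of \<open>U\<close> inside a large disc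
  about \<open>z0\<close>.\<close>

lemma extended_maximum_modulus:
  fixes h :: "complex \<Rightarrow> complex"
  assumes "open U" and hol: "h holomorphic_on U" and cont: "continuous_on (closure U) h"
    and "\<rho> > 0" and away: "\<And>z. z \<in> closure U \<Longrightarrow> \<rho> \<le> norm (z - z0)"
    and bdd: "\<And>z. z \<in> closure U \<Longrightarrow> norm (h z) \<le> B"
    and bound: "\<And>z. z \<in> frontier U \<Longrightarrow> norm (h z) \<le> M"
    and "M > 0" and "w \<in> U"
  shows "norm (h w) \<le> M"
proof (rule ccontr)
  assume "\<not> norm (h w) \<le> M"
  then have "1 < norm (h w) / M" using \<open>M > 0\<close> by simp
  \<comment> \<open>This \<open>n\<close> forces \<open>norm (F w) > 1\<close> for the
    \<open>F\<close> defined below.\<close>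
  then obtain n where n: "norm (w - z0) / \<rho> < (norm (h w) / M) ^ n"
    using real_arch_pow by blast
  define X where "X = (norm (h w) / M) ^ n"
  define F where "F = (\<lambda>z. (h z / of_real M) ^ n * (of_real \<rho> / (z - z0)))"
  \<comment> \<open>The first entry puts \<open>w\<close> inside the disc. The second makes the
    decay factor outweigh \<open>(B / M) ^ n\<close> at distance \<open>L\<close> or more from
    \<open>z0\<close>, so \<open>norm (F z) \<le> 1\<close> also on the frontier of \<open>S\<close>
    away from that of \<open>U\<close>.\<close>
  define L where "L = max (norm (w - z0) + 1) (\<rho> * (B / M) ^ n)"
  define S where "S = U \<inter> ball z0 L"
  have clS: "closure S \<subseteq> closure U" "closure S \<subseteq> cball z0 L"
    unfolding S_def by (meson closure_mono inf_le1, metis ball_subset_cball closed_cball closure_minimal inf_le2 order_trans)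
  have nz: "z - z0 \<noteq> 0" if "z \<in> closure U" for z
    using away[OF that] \<open>\<rho> > 0\<close> by auto
  have "open S" unfolding S_def using \<open>open U\<close> by auto
  have "norm (F w) \<le> 1"
  proof (rule maximum_modulus_frontier[of F S])
    show "F holomorphic_on interior S"
      unfolding F_def interior_open[OF \<open>open S\<close>] using nz closure_subset \<open>M > 0\<close>
      by (intro holomorphic_intros holomorphic_on_subset[OF hol]) (auto simp: S_def)
    show "continuous_on (closure S) F"
      unfolding F_def using continuous_on_subset[OF cont clS(1)] nz clS(1) \<open>M > 0\<close>
      by (intro continuous_intros) auto
    show "bounded S" unfolding S_def by (simp add: bounded_Int)
    show "w \<in> S" using \<open>w \<in> U\<close> by (auto simp: S_def L_def dist_norm norm_minus_commute)
    show "norm (F z) \<le> 1" if "z \<in> frontier S" for z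
    proof -
      have zU: "z \<in> closure U" using that clS by (auto simp: frontier_def)
      have F: "norm (F z) = (norm (h z) / M) ^ n * (\<rho> / norm (z - z0))"
        using \<open>M > 0\<close> \<open>\<rho> > 0\<close> by (simp add: F_def norm_mult norm_power norm_divide)
      have pos: "norm (z - z0) > 0" using nz zU by simp
      show ?thesis
      proof (cases "z \<in> frontier U")
        case True
        then have "(norm (h z) / M) ^ n \<le> 1"
          using bound \<open>M > 0\<close> by (intro power_le_one) auto
        moreover have "\<rho> / norm (z - z0) \<le> 1" using away[OF zU] pos by simp
        ultimately show ?thesis unfolding F using \<open>\<rho> > 0\<close> by (intro mult_le_one) auto
      next
        case False
        then have "z \<in> U" using zU \<open>open U\<close> by (auto simp: frontier_def interior_open)
        moreover have "z \<notin> S" using that \<open>open S\<close> by (auto simp: frontier_def interior_open)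
        ultimately have "L \<le> norm (z - z0)"
          by (auto simp: S_def dist_norm norm_minus_commute)
        then have "\<rho> * (B / M) ^ n \<le> norm (z - z0)" by (simp add: L_def)
        moreover have "(norm (h z) / M) ^ n \<le> (B / M) ^ n"
          using bdd[OF zU] \<open>M > 0\<close> by (intro power_mono divide_right_mono) auto
        then have "\<rho> * (norm (h z) / M) ^ n \<le> \<rho> * (B / M) ^ n" using \<open>\<rho> > 0\<close> by simp
        ultimately have "\<rho> * (norm (h z) / M) ^ n \<le> norm (z - z0)" by linarith
        then show ?thesis unfolding F using pos by (simp add: mult.commute)
      qed
    qed
  qed
  moreover have "norm (F w) = X * (\<rho> / norm (w - z0))"
    using \<open>M > 0\<close> \<open>\<rho> > 0\<close> by (simp add: F_def norm_mult norm_power norm_divide X_def)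
  moreover have "norm (w - z0) > 0" using nz \<open>w \<in> U\<close> closure_subset by fastforce
  ultimately show False using n[folded X_def] \<open>\<rho> > 0\<close> by (simp add: field_simps)
qed

section \<open>Density of the image of a preimage component\<close>

text \<open>If the closure of the image did not contain some \<open>b\<close> near one of its points, then
  \<open>1 / (g - b)\<close> would be bounded on the component, with a smaller bound on the frontier than
  inside.\<close>

lemma component_vimage_image_dense:
  fixes g :: "complex \<Rightarrow> complex"
  assumes hol: "g holomorphic_on UNIV" and nc: "\<not> g constant_on UNIV"
    and V: "open V" "connected V" "bounded V" and "g x \<in> V"
  shows "V \<subseteq> closure (g ` connected_component_set (g -` V) x)"
proof -
  define U where "U = connected_component_set (g -` V) x"
  have contg: "continuous_on UNIV g" using hol holomorphic_on_imp_continuous_on by blast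
  have "open U" unfolding U_def
    using contg V by (intro open_connected_component open_vimage) auto
  have UV: "g ` U \<subseteq> V" using connected_component_subset unfolding U_def by fastforce
  have "x \<in> U" using \<open>g x \<in> V\<close> by (simp add: U_def)
  \<comment> \<open>The frontier of a component lies in the frontier of the whole preimage, which is
    disjoint from that open preimage.\<close>
  have fr: "g z \<notin> V" if "z \<in> frontier U" for z
    using that frontier_of_connected_component_subset[of "g -` V" x] open_vimage[OF V(1) contg]
    unfolding U_def frontier_def by (auto simp: interior_open)
  have clU: "g ` closure U \<subseteq> closure V"
    by (metis UV closure_mono contg image_closure_subset closed_closure closure_subset continuous_on_subset order_trans subset_UNIV)
  \<comment> \<open>By Liouville some value \<open>g z0\<close> avoids the closure of the bounded
    set \<open>V\<close>. This yields the disc missed by the closure of \<open>U\<close> that the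
    maximum principle asks for.\<close>
  have "\<not> bounded (range g)"
    using hol nc Liouville_theorem[of g] by (auto simp: constant_on_def)
  then obtain z0 where z0: "g z0 \<notin> closure V"
    using bounded_closure[OF V(3)] by (metis bounded_subset image_subsetI)
  then have "z0 \<in> - closure U" using clU by blast
  then obtain \<rho> where "\<rho> > 0" and \<rho>: "ball z0 \<rho> \<subseteq> - closure U"
    by (meson open_Compl closed_closure openE)
  have away: "\<rho> \<le> norm (z - z0)" if "z \<in> closure U" for z
    using \<rho> that by (force simp: dist_norm norm_minus_commute)
  \<comment> \<open>On the frontier, \<open>g\<close> stays at distance at least
    \<open>2 * r\<close> from \<open>a\<close>, hence at least \<open>r\<close> from
    \<open>b\<close>; so \<open>1 / (g - b)\<close> is bounded there by \<open>1 / r\<close>. A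
    point \<open>w\<close> of \<open>U\<close> with \<open>g w\<close> closer than \<open>r\<close>
    to \<open>b\<close> violates this bound.\<close>
  have nbhd: "b \<in> closure (g ` U)"
    if a: "a \<in> closure (g ` U)" and "r > 0" and r: "ball a (2 * r) \<subseteq> V" and b: "dist a b < r" for a b r
  proof (rule ccontr)
    assume "b \<notin> closure (g ` U)"
    then obtain d where "d > 0" and d: "ball b d \<subseteq> - closure (g ` U)"
      by (meson ComplI open_Compl closed_closure openE)
    have dU: "d \<le> norm (g z - b)" if "z \<in> closure U" for z
    proof -
      have "g z \<in> closure (g ` U)"
        using that contg by (metis closed_closure closure_subset continuous_on_subset image_closure_subset image_subset_iff subset_UNIV)
      then show ?thesis using d by (force simp: dist_norm norm_minus_commute)
    qed
    have nz: "g z - b \<noteq> 0" if "z \<in> closure U" for z using dU[OF that] \<open>d > 0\<close> by auto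
    obtain w where w: "w \<in> U" "dist (g w) a < r - dist a b"
      using a b unfolding closure_approachable by (metis diff_gt_0_iff_gt imageE)
    then have "norm (g w - b) < r"
      using dist_triangle[of "g w" b a] by (simp add: dist_norm)
    moreover have "norm (1 / (g w - b)) \<le> 1 / r"
    proof (rule extended_maximum_modulus[where h="\<lambda>z. 1 / (g z - b)", OF \<open>open U\<close> _ _ \<open>\<rho> > 0\<close> away _ _ _ \<open>w \<in> U\<close>])
      show "(\<lambda>z. 1 / (g z - b)) holomorphic_on U"
        using nz closure_subset by (intro holomorphic_intros holomorphic_on_subset[OF hol]) auto
      show "continuous_on (closure U) (\<lambda>z. 1 / (g z - b))"
        using nz by (intro continuous_intros continuous_on_subset[OF contg]) auto
      show "norm (1 / (g z - b)) \<le> 1 / d" if "z \<in> closure U" for z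
        using dU[OF that] \<open>d > 0\<close> by (simp add: norm_divide frac_le)
      show "norm (1 / (g z - b)) \<le> 1 / r" if "z \<in> frontier U" for z
      proof -
        have "2 * r \<le> dist a (g z)" using fr[OF that] r by force
        then have "r \<le> norm (g z - b)"
          using b dist_triangle[of a "g z" b] by (simp add: dist_norm norm_minus_commute)
        then show ?thesis using \<open>r > 0\<close> by (simp add: norm_divide frac_le)
      qed
    qed (use \<open>r > 0\<close> in auto)
    moreover have "norm (g w - b) > 0" using nz w closure_subset by fastforce
    ultimately show False using \<open>r > 0\<close> by (simp add: norm_divide field_simps)
  qed
  \<comment> \<open>The set is also relatively closed in the connected set \<open>V\<close> and
    contains \<open>g x\<close>, so it is all of \<open>V\<close>.\<close>
  have "open (V \<inter> closure (g ` U))"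
    unfolding open_dist
  proof
    fix a assume a: "a \<in> V \<inter> closure (g ` U)"
    then obtain s where "s > 0" and s: "ball a s \<subseteq> V" using V(1) openE by blast
    then have "\<forall>b. dist b a < s / 2 \<longrightarrow> b \<in> V \<inter> closure (g ` U)"
      using nbhd[of a "s / 2"] a by (auto simp: dist_commute subset_iff)
    then show "\<exists>e>0. \<forall>b. dist b a < e \<longrightarrow> b \<in> V \<inter> closure (g ` U)"
      using \<open>s > 0\<close> by (intro exI[of _ "s / 2"]) auto
  qed
  then have "V \<inter> closure (g ` U) = {} \<or> V \<subseteq> closure (g ` U)"
    using connectedD[OF V(2), of "V \<inter> closure (g ` U)" "- closure (g ` U)"] by blast
  moreover have "g x \<in> V \<inter> closure (g ` U)"
    using \<open>x \<in> U\<close> \<open>g x \<in> V\<close> closure_subset[of "g ` U"] by blast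
  ultimately show ?thesis unfolding U_def by blast
qed

section \<open>Concatenating paths and covering arcs\<close>

lemma glue_paths:
  fixes p :: "nat \<Rightarrow> real \<Rightarrow> 'a::topological_space"
  assumes path: "\<And>k. path (p k)" and joint: "\<And>k. pathfinish (p k) = pathstart (p (Suc k))"
  obtains \<Gamma> :: "real \<Rightarrow> 'a" where "continuous_on {0..} \<Gamma>"
    "\<And>t. 0 \<le> t \<Longrightarrow> \<Gamma> t \<in> path_image (p (nat \<lfloor>t\<rfloor>))"
proof -
  \<comment> \<open>Path \<open>p k\<close> is run on \<open>[k, k + 1)\<close>. At the right
    endpoint the floor has already jumped, and \<open>joint\<close> identifies the two
    values.\<close>
  define \<Gamma> where "\<Gamma> = (\<lambda>t::real. p (nat \<lfloor>t\<rfloor>) (t - \<lfloor>t\<rfloor>))"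
  have in_p: "\<Gamma> t \<in> path_image (p (nat \<lfloor>t\<rfloor>))" if "0 \<le> t" for t
    unfolding \<Gamma>_def path_image_def by (rule imageI) (auto, linarith)
  have piece: "continuous_on {real n..real (Suc n)} \<Gamma>" for n
  proof -
    have "continuous_on {real n..real (Suc n)} (\<lambda>t. p n (t - real n))"
      using path[of n] unfolding path_def
      by (rule continuous_on_compose2) (auto intro!: continuous_intros)
    moreover have "p n (t - real n) = \<Gamma> t" if "t \<in> {real n..real (Suc n)}" for t
    proof (cases "t = real (Suc n)")
      case True
      then have "\<lfloor>t\<rfloor> = int (Suc n)" by (metis floor_of_nat)
      then show ?thesis using joint[of n] True 
        unfolding \<Gamma>_def pathstart_def pathfinish_def by (auto simp: nat_add_distrib)
    next
      case False
      then have "\<lfloor>t\<rfloor> = int n" using that by (intro floor_unique) auto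
      then show ?thesis by (simp add: \<Gamma>_def)
    qed
    ultimately show ?thesis by (rule continuous_on_eq)
  qed
  have initial: "continuous_on {0..real n} \<Gamma>" for n
  proof (induction n)
    case 0
    then show ?case by simp
  next
    case (Suc n)
    have "{0..real (Suc n)} = {0..real n} \<union> {real n..real (Suc n)}" by auto
    then show ?case using continuous_on_closed_Un[OF _ _ Suc piece] by simp
  qed
  have "continuous_on {0..} \<Gamma>"
    unfolding continuous_on_eq_continuous_within
  proof
    fix t :: real assume "t \<in> {0..}"
    obtain n where n: "t < real n" using reals_Archimedean2 by blast
    have "continuous (at t within {0..real n}) \<Gamma>"
      using initial \<open>t \<in> {0..}\<close> n unfolding continuous_on_eq_continuous_within by auto
    moreover have "at t within {0..real n} = at t within {0..}"
      by (rule at_within_nhd[of t "{..<real n}"]) (use n in auto)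
    ultimately show "continuous (at t within {0..}) \<Gamma>" by simp
  qed
  then show thesis using in_p by (rule that)
qed

text \<open>The union of small open neighbourhoods of the points of the arc has the required
  closeness, and compactness of the arc bounds it. Its component at \<open>\<gamma> a\<close> still
  contains the whole arc, as the arc is connected.\<close>

lemma connected_cover_of_curve:
  fixes f :: "'a::real_normed_vector \<Rightarrow> 'b::metric_space"
  assumes f: "continuous_on UNIV f" and \<gamma>: "continuous_on {a..b::real} \<gamma>" and "e > 0"
  obtains V where "open V" "connected V" "bounded V" "\<gamma> ` {a..b} \<subseteq> V"
    "\<And>w. w \<in> V \<Longrightarrow> \<exists>s\<in>{a..b}. dist w (\<gamma> s) < 1 \<and> dist (f w) (f (\<gamma> s)) < e"
proof
  define W where "W = (\<Union>s\<in>{a..b}. ball (\<gamma> s) 1 \<inter> f -` ball (f (\<gamma> s)) e)"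
  define V where "V = connected_component_set W (\<gamma> a)"
  have "open W" unfolding W_def using f by (auto intro!: open_UN open_vimage)
  then show "open V" unfolding V_def by (rule open_connected_component)
  show "connected V" unfolding V_def by simp
  have "V \<subseteq> W" unfolding V_def by (rule connected_component_subset)
  then show "\<exists>s\<in>{a..b}. dist w (\<gamma> s) < 1 \<and> dist (f w) (f (\<gamma> s)) < e" if "w \<in> V" for w
    using that by (fastforce simp: W_def dist_commute)
  have "compact (\<gamma> ` {a..b})" using \<gamma> by (simp add: compact_continuous_image)
  then obtain B where B: "\<And>s. s \<in> {a..b} \<Longrightarrow> norm (\<gamma> s) \<le> B"
    by (metis bounded_iff compact_imp_bounded imageI)
  have "W \<subseteq> cball 0 (B + 1)"
  proof
    fix w assume "w \<in> W"
    then obtain s where "s \<in> {a..b}" "dist (\<gamma> s) w < 1" by (auto simp: W_def)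
    then show "w \<in> cball 0 (B + 1)"
      using B[of s] norm_triangle_sub[of w "\<gamma> s"] by (auto simp: dist_norm norm_minus_commute)
  qed
  then show "bounded V" using \<open>V \<subseteq> W\<close> bounded_cball bounded_subset by blast
  have sub: "\<gamma> ` {a..b} \<subseteq> W" using \<open>e > 0\<close> by (force simp: W_def)
  show "\<gamma> ` {a..b} \<subseteq> V"
  proof (cases "a \<le> b")
    case True
    then show ?thesis unfolding V_def
      by (intro connected_component_maximal sub connected_continuous_image \<gamma>) auto
  qed simp
qed

section \<open>Asymptotic values of the composition\<close>

lemma asymptotic_values_compose:
  fixes f g :: "complex \<Rightarrow> complex"
  assumes f: "continuous_on UNIV f" and hol: "g holomorphic_on UNIV" and nc: "\<not> g constant_on UNIV"
  shows "asymptotic_values f \<subseteq> asymptotic_values (f \<circ> g)"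
proof
  fix \<zeta> assume "\<zeta> \<in> asymptotic_values f"
  then obtain \<gamma> :: "real \<Rightarrow> complex" where \<gamma>: "continuous_on {0..} \<gamma>" and \<gamma>inf: "filterlim \<gamma> at_infinity at_top"
    and lim: "((\<lambda>t. f (\<gamma> t)) \<longlongrightarrow> \<zeta>) at_top"
    by (auto simp: asymptotic_values_def curve_to_infinity_def)
  have contg: "continuous_on UNIV g" using hol holomorphic_on_imp_continuous_on by blast
  \<comment> \<open>The tolerance for \<open>f\<close> shrinks with \<open>k\<close>, so that the
    new curve inherits the limit \<open>\<zeta>\<close>.\<close>
  have "\<exists>V. open V \<and> connected V \<and> bounded V \<and> \<gamma> ` {real k..real (Suc k)} \<subseteq> V \<and>
    (\<forall>w\<in>V. \<exists>s\<in>{real k..real (Suc k)}. dist w (\<gamma> s) < 1 \<and> dist (f w) (f (\<gamma> s)) < inverse (Suc k))" for k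
    by (rule connected_cover_of_curve[OF f continuous_on_subset[OF \<gamma>], of "real k" "real (Suc k)" "inverse (Suc k)"]) (force, simp, blast)
  then obtain V where V: "\<And>k. open (V k)" "\<And>k. connected (V k)" "\<And>k. bounded (V k)"
      "\<And>k. \<gamma> ` {real k..real (Suc k)} \<subseteq> V k"
    and near: "\<And>k w. w \<in> V k \<Longrightarrow>
      \<exists>s\<in>{real k..real (Suc k)}. dist w (\<gamma> s) < 1 \<and> dist (f w) (f (\<gamma> s)) < inverse (Suc k)"
    by metis
  define U where "U = (\<lambda>k z. connected_component_set (g -` V k) z)"
  \<comment> \<open>\<open>V 0\<close> contains two distinct points, and by little Picard the
    nonconstant \<open>g\<close> cannot omit both.\<close>
  have "\<exists>z. g z \<in> V 0"
  proof -
    have "\<gamma> 0 \<in> V 0" using V(4)[of 0] by auto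
    then obtain d where "d > 0" "cball (\<gamma> 0) d \<subseteq> V 0" using V(1) open_contains_cball by metis
    moreover have "\<gamma> 0 + of_real d \<in> cball (\<gamma> 0) d" using \<open>d > 0\<close> by (simp add: dist_norm)
    ultimately have "\<gamma> 0 + of_real d \<in> V 0" "\<gamma> 0 + of_real d \<noteq> \<gamma> 0" by auto
    moreover have "range g \<inter> {\<gamma> 0, \<gamma> 0 + of_real d} \<noteq> {}"
    proof
      assume "range g \<inter> {\<gamma> 0, \<gamma> 0 + of_real d} = {}"
      then obtain c where "g = (\<lambda>x. c)"
        using little_Picard[OF hol, of "\<gamma> 0" "\<gamma> 0 + of_real d"] \<open>d > 0\<close> by auto
      then show False using nc by (simp add: constant_on_def)
    qed
    ultimately show ?thesis using \<open>\<gamma> 0 \<in> V 0\<close> by auto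
  qed
  \<comment> \<open>Consecutive covers share \<open>\<gamma> (k + 1)\<close>; by density the open
    set \<open>V (Suc k)\<close> around it meets the image of the component.\<close>
  moreover have "\<exists>z'. g z' \<in> V (Suc k) \<and> z' \<in> U k z" if "g z \<in> V k" for k z
  proof -
    have "\<gamma> (real (Suc k)) \<in> V k \<inter> V (Suc k)" using V(4)[of k] V(4)[of "Suc k"] by auto
    moreover have "V k \<subseteq> closure (g ` U k z)"
      unfolding U_def by (rule component_vimage_image_dense[OF hol nc V(1-3) that])
    ultimately have "V (Suc k) \<inter> g ` U k z \<noteq> {}"
      using open_Int_closure_eq_empty[OF V(1)] by blast
    then show ?thesis by blast
  qed
  ultimately obtain z where z: "\<And>k. g (z k) \<in> V k" "\<And>k. z (Suc k) \<in> U k (z k)"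
    using dependent_nat_choice[of "\<lambda>k z. g z \<in> V k" "\<lambda>k z z'. z' \<in> U k z"] by auto
  have "\<exists>p. path p \<and> path_image p \<subseteq> U k (z k) \<and> pathstart p = z k \<and> pathfinish p = z (Suc k)" for k
  proof -
    have "open (U k (z k))" unfolding U_def
      using contg V(1) by (intro open_connected_component open_vimage)
    then have "path_connected (U k (z k))"
      by (intro connected_open_path_connected) (simp_all add: U_def)
    moreover have "z k \<in> U k (z k)" using z by (simp add: U_def)
    ultimately show ?thesis using z(2) unfolding path_connected_def by metis
  qed
  then obtain p where p: "\<And>k. path (p k)" "\<And>k. path_image (p k) \<subseteq> U k (z k)"
      "\<And>k. pathstart (p k) = z k" "\<And>k. pathfinish (p k) = z (Suc k)"
    by metis
  obtain \<Gamma> :: "real \<Rightarrow> complex" where \<Gamma>: "continuous_on {0..} \<Gamma>"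
    and in_p: "\<And>t. 0 \<le> t \<Longrightarrow> \<Gamma> t \<in> path_image (p (nat \<lfloor>t\<rfloor>))"
    by (rule glue_paths[of p]) (simp add: p, simp add: p, blast)
  \<comment> \<open>With \<open>k\<close> the floor of \<open>t\<close>, the parameter
    \<open>s\<close> lies in \<open>[k, k + 1]\<close>, and \<open>k \<le> t < k + 1\<close> turns
    the estimates in \<open>k\<close> into estimates in \<open>t\<close>.\<close>
  have "\<exists>s. t - 1 \<le> s \<and> dist (g (\<Gamma> t)) (\<gamma> s) < 1 \<and> dist (f (g (\<Gamma> t))) (f (\<gamma> s)) < inverse t"
    if "t > 0" for t :: real
  proof -
    let ?k = "nat \<lfloor>t\<rfloor>"
    have "\<Gamma> t \<in> U ?k (z ?k)" using in_p[of t] p(2) that by auto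
    then have "g (\<Gamma> t) \<in> V ?k"
      unfolding U_def using connected_component_subset by fastforce
    then obtain s where s: "s \<in> {real ?k..real (Suc ?k)}" "dist (g (\<Gamma> t)) (\<gamma> s) < 1"
        "dist (f (g (\<Gamma> t))) (f (\<gamma> s)) < inverse (Suc ?k)"
      using near by blast
    have "t - 1 \<le> real ?k" "t \<le> real (Suc ?k)" using that by linarith+
    moreover have "inverse (real (Suc ?k)) \<le> inverse t"
      using \<open>t \<le> real (Suc ?k)\<close> that by (rule le_imp_inverse_le)
    ultimately show ?thesis using s by (intro exI[of _ s]) auto
  qed
  \<comment> \<open>\<open>\<sigma>\<close> is a bare choice of parameters, with no continuity
    claimed; the lower bound \<open>t - 1\<close> sends it to infinity.\<close>
  then obtain \<sigma> :: "real \<Rightarrow> real" where \<sigma>: "\<And>t. t > 0 \<Longrightarrow> t - 1 \<le> \<sigma> t"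
      "\<And>t. t > 0 \<Longrightarrow> dist (g (\<Gamma> t)) (\<gamma> (\<sigma> t)) < 1"
      "\<And>t. t > 0 \<Longrightarrow> dist (f (g (\<Gamma> t))) (f (\<gamma> (\<sigma> t))) < inverse t"
    by metis
  have \<sigma>inf: "filterlim \<sigma> at_top at_top"
  proof (rule filterlim_at_top_mono)
    show "filterlim (\<lambda>t::real. t - 1) at_top at_top"
      using filterlim_tendsto_add_at_top[OF tendsto_const[of "-1"] filterlim_ident] by simp
    show "\<forall>\<^sub>F t in at_top. t - 1 \<le> \<sigma> t"
      using eventually_gt_at_top[of 0] by eventually_elim (rule \<sigma>)
  qed
  have "((\<lambda>t. f (g (\<Gamma> t)) - f (\<gamma> (\<sigma> t))) \<longlongrightarrow> 0) at_top"
  proof (rule Lim_null_comparison)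
    show "\<forall>\<^sub>F t in at_top. norm (f (g (\<Gamma> t)) - f (\<gamma> (\<sigma> t))) \<le> inverse t"
      using eventually_gt_at_top[of 0]
      by eventually_elim (use \<sigma>(3) less_imp_le in \<open>auto simp: dist_norm\<close>)
    show "((\<lambda>t::real. inverse t) \<longlongrightarrow> 0) at_top"
      by (rule tendsto_inverse_0_at_top[OF filterlim_ident])
  qed
  moreover have "((\<lambda>t. f (\<gamma> (\<sigma> t))) \<longlongrightarrow> \<zeta>) at_top"
    by (rule filterlim_compose[OF lim \<sigma>inf])
  ultimately have "((\<lambda>t. f (g (\<Gamma> t))) \<longlongrightarrow> \<zeta>) at_top"
    by (rule Lim_transform[rotated])
  moreover have "filterlim \<Gamma> at_infinity at_top"
    unfolding filterlim_at_infinity[OF order_refl]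
  proof (intro allI impI)
    fix r :: real assume "r > 0"
    have "bounded (g ` cball 0 r)"
      by (intro compact_imp_bounded compact_continuous_image continuous_on_subset[OF contg]) auto
    then obtain B where B: "\<And>z. norm z \<le> r \<Longrightarrow> norm (g z) \<le> B"
      unfolding bounded_iff by (metis imageI mem_cball_0)
    have "filterlim (\<lambda>t. \<gamma> (\<sigma> t)) at_infinity at_top"
      by (rule filterlim_compose[OF \<gamma>inf \<sigma>inf])
    \<comment> \<open>The summand 1 absorbs the distance from \<open>g (\<Gamma> t)\<close> to
      \<open>\<gamma> (\<sigma> t)\<close>; the absolute value keeps the threshold positive.\<close>
    then have "\<forall>\<^sub>F t in at_top. \<bar>B\<bar> + 1 \<le> norm (\<gamma> (\<sigma> t))"
      unfolding filterlim_at_infinity[OF order_refl] by auto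
    then show "\<forall>\<^sub>F t in at_top. r \<le> norm (\<Gamma> t)"
      using eventually_gt_at_top[of 0]
    proof eventually_elim
      case (elim t)
      then have "B < norm (g (\<Gamma> t))"
        using \<sigma>(2)[of t] norm_triangle_sub[of "\<gamma> (\<sigma> t)" "g (\<Gamma> t)"]
        by (simp add: dist_norm norm_minus_commute)
      then show ?case using B[of "\<Gamma> t"] by linarith
    qed
  qed
  ultimately show "\<zeta> \<in> asymptotic_values (f \<circ> g)"
    using \<Gamma> by (auto simp: asymptotic_values_def curve_to_infinity_def)
qed

section \<open>Critical values and the theorem\<close>

lemma critical_values_compose:
  assumes "f holomorphic_on UNIV" "g holomorphic_on UNIV"
  shows "g ` critical_values f \<subseteq> critical_values (g \<circ> f)"
proof -
  \<comment> \<open>The factor \<open>deriv f z\<close> makes every critical point of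
    \<open>f\<close> one of \<open>g \<circ> f\<close>.\<close>
  have "deriv (g \<circ> f) z = deriv g (f z) * deriv f z" for z
    using assms by (intro deriv_chain) (auto simp: holomorphic_on_imp_differentiable_at)
  then show ?thesis by (fastforce simp: critical_values_def)
qed

theorem theorem2p9:
  fixes f g :: "complex \<Rightarrow> complex"
  assumes "transcendental_entire f" and "transcendental_entire g"
  shows "asymptotic_values f \<subseteq> asymptotic_values (f \<circ> g)
    \<and> g ` critical_values f \<subseteq> critical_values (g \<circ> f)"
proof -
  have hol: "f holomorphic_on UNIV" "g holomorphic_on UNIV"
    using assms by (auto simp: transcendental_entire_def)
  \<comment> \<open>A constant map is the polynomial \<open>[:c:]\<close>, which transcendence
    excludes.\<close>
  have "\<not> g constant_on UNIV"
  proof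
    assume "g constant_on UNIV"
    then obtain c where "\<forall>z. g z = poly [:c:] z" by (auto simp: constant_on_def)
    then show False using assms(2) unfolding transcendental_entire_def by blast
  qed
  then show ?thesis
    using asymptotic_values_compose critical_values_compose hol holomorphic_on_imp_continuous_on by blast
qed

end
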